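(* For every positive integer $k$ there is a graph $G$ such that $\gamma_s(\mu(G)) - \gamma_s(G) = k$.
   Context: All graphs are finite, simple, connected, undirected, with nonempty vertex set (in particular the graph $G$ in the claim is connected). A set $S\subseteq V(G)$ is a dominating set of $G$ if every vertex of $V(G)\setminus S$ is adjacent to some vertex of $S$. A dominating set $S$ is a secure dominating set of $G$ if for every $u\in V(G)\setminus S$ there is $v\in S$ adjacent to $u$ such that $(S\setminus\{v\})\cup\{u\}$ is a dominating set of $G$. The secure domination number $\gamma_s(G)$ is the minimum cardinality of a secure dominating set of $G$. For a graph $G$ with vertices $v_1,\dots,v_n$, the Mycielskian $\mu(G)$ is the graph with vertex set $\{v_1,\dots,v_n,u_1,\dots,u_n,w\}$ ($2n+1$ distinct vertices) whose edges are: all edges of $G$; the edges $wu_i$ for $1\le i\le n$; and, for each edge $v_iv_j$ of $G$, the edges $u_iv_j$ and $v_iu_j$. *)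

theory Defs
  imports "Graph_Theory.Digraph_Component" "Graph_Theory.Pair_Digraph"
begin

text \<open>
  A finite simple graph is a \<^locale>\<open>pair_graph\<close>: a finite loop-free digraph whose arc set is
  symmetric, each edge being represented by its two orientations. \<^const>\<open>connected\<close> includes
  nonemptiness of the vertex set.
\<close>

definition dominating_set :: "('a, 'b) pre_digraph \<Rightarrow> 'a set \<Rightarrow> bool" where
  "dominating_set G S \<longleftrightarrow> S \<subseteq> verts G \<and> (\<forall>u \<in> verts G - S. \<exists>v \<in> S. u \<rightarrow>\<^bsub>G\<^esub> v)"

definition secure_dominating_set :: "('a, 'b) pre_digraph \<Rightarrow> 'a set \<Rightarrow> bool" where
  "secure_dominating_set G S \<longleftrightarrow> dominating_set G S \<and>
     (\<forall>u \<in> verts G - S. \<exists>v \<in> S. u \<rightarrow>\<^bsub>G\<^esub> v \<and> dominating_set G ((S - {v}) \<union> {u}))"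

definition secure_domination_number :: "('a, 'b) pre_digraph \<Rightarrow> nat" where
  "secure_domination_number G = Min (card ` {S. secure_dominating_set G S})"

text \<open>The minimum is taken over a finite nonempty set whenever the graph is finite.\<close>

lemma finite_secure_dominating_sets:
  "finite (verts G) \<Longrightarrow> finite {S. secure_dominating_set G S}"
  by (rule finite_subset[of _ "Pow (verts G)"])
    (auto simp: secure_dominating_set_def dominating_set_def)

lemma secure_dominating_set_verts: "secure_dominating_set G (verts G)"
  by (simp add: secure_dominating_set_def dominating_set_def)

datatype 'a mycielskian_vertex = Orig 'a | Copy 'a | Apex

text \<open>
  \<open>Orig x\<close> is the vertex $x = v_i$ of the original graph, \<open>Copy x\<close> its copy $u_i$, and \<open>Apex\<close> is $w$.
\<close>

definition mycielskian :: "'a pair_pre_digraph \<Rightarrow> 'a mycielskian_vertex pair_pre_digraph" where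
  "mycielskian G = \<lparr>
     pverts = Orig ` pverts G \<union> Copy ` pverts G \<union> {Apex},
     parcs = {(Orig x, Orig y) | x y. (x, y) \<in> parcs G}
       \<union> {(Apex, Copy x) | x. x \<in> pverts G} \<union> {(Copy x, Apex) | x. x \<in> pverts G}
       \<union> {(Copy x, Orig y) | x y. (x, y) \<in> parcs G}
       \<union> {(Orig x, Copy y) | x y. (x, y) \<in> parcs G} \<rparr>"

lemma pair_graph_mycielskian:
  assumes "pair_graph G"
  shows "pair_graph (mycielskian G)"
proof -
  interpret pair_graph G by (fact assms)
  let ?V = "pverts (mycielskian G)"
  have sub: "parcs (mycielskian G) \<subseteq> ?V \<times> ?V"
    by (auto simp: mycielskian_def dest: in_arcsD1 in_arcsD2)
  have finV: "finite ?V"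
    using pair_finite_verts by (simp add: mycielskian_def)
  have finA: "finite (parcs (mycielskian G))"
    using finite_subset[OF sub] finV by simp
  have sym: "sym (parcs (mycielskian G))"
    using pair_sym_arcs by (auto simp: mycielskian_def symmetric_def sym_def)
  show ?thesis
  proof
    fix e assume e: "e \<in> parcs (mycielskian G)"
    show "fst e \<in> ?V" "snd e \<in> ?V" using e sub by auto
    show "fst e \<noteq> snd e" using e no_loops' by (auto simp: mycielskian_def)
  qed (use finV finA sym in \<open>simp_all add: symmetric_def\<close>)
qed

end

theory Submission
  imports Defs
begin

text \<open>
  The witness is a clique on \<open>k\<close> vertices, the hips, with a path hip -- knee -- foot attached at
  each of them. A foot has the knee of its leg as only neighbour, so every leg needs a member of a
  dominating set; this keeps the legs almost independent of each other, and the clique is there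
  to make the graph connected without letting one leg help to guard the lower part of another.

  In the legged clique itself one vertex per leg nearly suffices: all knees dominate, but when a
  foot is attacked its knee has to step down and leaves the hip above it unguarded. One additional
  guard on a single hip repairs this for all legs at once, since hips see each other. Hence the
  secure domination number is \<open>k + 1\<close>.

  In the Mycielskian every leg costs two guards. The foot and its copy are not adjacent, and the
  only vertex of the doubled leg that is adjacent to both is the knee; a knee that defends one of
  them abandons the other. The apex can stand in for the copies, but then it is no longer
  available once it has moved, and a lone guard in some leg is always defeated by a suitable
  attack (\<open>double_leg_card_ge\<close>). So at least \<open>2 k\<close> guards stand in the doubled legs. If the apex
  is guarded as well, the total is at least \<open>2 k + 1\<close>. If it is not, then a doubled leg with
  exactly two guards has none of them on the hip or its copy (\<open>hip_notin_tight_double_leg\<close>); were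
  all legs like this, the copy of a hip could only be defended by its knee, and that
  defence fails further down in the same leg. Conversely, all knees and all hips together with the
  apex are secure, because knees and hips form a total dominating set. Hence the secure
  domination number of the Mycielskian is \<open>2 k + 1\<close>, and the difference is \<open>k\<close>.
\<close>

section \<open>Secure domination\<close>

lemma dominating_setD:
  assumes "dominating_set G S" "u \<in> verts G"
  shows "u \<in> S \<or> (\<exists>v \<in> S. u \<rightarrow>\<^bsub>G\<^esub> v)"
  using assms by (auto simp: dominating_set_def)

lemma dominating_setI:
  assumes "S \<subseteq> verts G" "\<And>u. u \<in> verts G \<Longrightarrow> u \<in> S \<or> (\<exists>v \<in> S. u \<rightarrow>\<^bsub>G\<^esub> v)"
  shows "dominating_set G S"
  using assms by (auto simp: dominating_set_def)

lemma secure_dominating_setE: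
  assumes "secure_dominating_set G S" "u \<in> verts G" "u \<notin> S"
  obtains v where "v \<in> S" "u \<rightarrow>\<^bsub>G\<^esub> v" "dominating_set G (insert u (S - {v}))"
  using assms by (auto simp: secure_dominating_set_def)

lemma secure_domination_number_eqI:
  assumes "finite (verts G)" "secure_dominating_set G S" "card S = n"
    and "\<And>T. secure_dominating_set G T \<Longrightarrow> n \<le> card T"
  shows "secure_domination_number G = n"
  unfolding secure_domination_number_def
proof (rule Min_eqI)
  show "finite (card ` {S. secure_dominating_set G S})"
    using assms(1) by (intro finite_imageI finite_secure_dominating_sets)
  show "n \<le> c" if "c \<in> card ` {S. secure_dominating_set G S}" for c
    using that assms(4) by auto
  show "n \<in> card ` {S. secure_dominating_set G S}"
    using assms(2,3) by auto
qed

lemma finite_secure_dominating_set: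
  assumes "secure_dominating_set G S" "finite (verts G)"
  shows "finite S"
  using assms by (auto simp: secure_dominating_set_def dominating_set_def intro: finite_subset)

section \<open>Counting over disjoint blocks\<close>

lemma card_ge_disjoint_blocks:
  fixes B :: "nat \<Rightarrow> 'a set"
  assumes "finite S" "disjoint_family_on B {..<k}"
    and "\<And>i. i < k \<Longrightarrow> c \<le> card (S \<inter> B i)"
  shows "c * k \<le> card S"
proof -
  have "c * k = (\<Sum>i<k. c)" by simp
  also have "\<dots> \<le> (\<Sum>i<k. card (S \<inter> B i))"
    using assms(3) by (intro sum_mono) auto
  also have "\<dots> = card (\<Union>i<k. S \<inter> B i)"
    using assms(1,2) by (subst card_UN_disjoint) (auto simp: disjoint_family_on_def)
  also have "\<dots> \<le> card S"
    using assms(1) by (intro card_mono) auto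
  finally show ?thesis .
qed

text \<open>
  One block above the minimum makes the bound strict: a surplus element of that block can be
  discarded before counting.
\<close>

lemma card_gt_disjoint_blocks:
  fixes B :: "nat \<Rightarrow> 'a set"
  assumes "finite S" "disjoint_family_on B {..<k}"
    and "\<And>i. i < k \<Longrightarrow> c \<le> card (S \<inter> B i)"
    and j: "j < k" "c \<noteq> card (S \<inter> B j)"
  shows "c * k < card S"
proof -
  have "c < card (S \<inter> B j)" using assms(3)[OF j(1)] j(2) by simp
  then have "S \<inter> B j \<noteq> {}" by auto
  then obtain s where s: "s \<in> S" "s \<in> B j" by auto
  have "c * k \<le> card (S - {s})"
  proof (rule card_ge_disjoint_blocks[OF _ assms(2)])
    fix i assume i: "i < k"
    show "c \<le> card ((S - {s}) \<inter> B i)"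
    proof (cases "i = j")
      case True
      have "(S - {s}) \<inter> B j = (S \<inter> B j) - {s}" by auto
      then show ?thesis using True s \<open>c < card (S \<inter> B j)\<close> assms(1) by simp
    next
      case False
      then have "(S - {s}) \<inter> B i = S \<inter> B i"
        using i j s assms(2) by (auto simp: disjoint_family_on_def)
      then show ?thesis using assms(3)[OF i] by simp
    qed
  qed (use assms(1) in simp)
  also have "\<dots> < card S" using assms(1) s(1) by (rule card_Diff1_less)
  finally show ?thesis .
qed

section \<open>Cliques with a path attached at every vertex\<close>

text \<open>
  The residue modulo three tells the joint and the quotient tells the leg, so that the joints of
  all legs are distinct natural numbers.
\<close>

definition foot :: "nat \<Rightarrow> nat" where "foot i = 3 * i"
definition knee :: "nat \<Rightarrow> nat" where "knee i = 3 * i + 1"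
definition hip :: "nat \<Rightarrow> nat" where "hip i = 3 * i + 2"

lemma joint_eq_iff [simp]:
  "foot i = foot j \<longleftrightarrow> i = j" "knee i = knee j \<longleftrightarrow> i = j" "hip i = hip j \<longleftrightarrow> i = j"
  "foot i \<noteq> knee j" "knee i \<noteq> foot j" "foot i \<noteq> hip j" "hip i \<noteq> foot j"
  "knee i \<noteq> hip j" "hip i \<noteq> knee j"
  unfolding foot_def knee_def hip_def by presburger+

definition leg :: "nat \<Rightarrow> nat set" where "leg i = {foot i, knee i, hip i}"

definition legged_clique :: "nat \<Rightarrow> nat pair_pre_digraph" where
  "legged_clique k = \<lparr>
     pverts = (\<Union>i<k. leg i),
     parcs = (\<Union>i<k. {(foot i, knee i), (knee i, foot i), (knee i, hip i), (hip i, knee i)})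
       \<union> {(hip i, hip j) | i j. i < k \<and> j < k \<and> i \<noteq> j} \<rparr>"

lemma legged_clique_verts [simp]:
  "foot i \<in> pverts (legged_clique k) \<longleftrightarrow> i < k"
  "knee i \<in> pverts (legged_clique k) \<longleftrightarrow> i < k"
  "hip i \<in> pverts (legged_clique k) \<longleftrightarrow> i < k"
  by (auto simp: legged_clique_def leg_def)

lemma legged_clique_vertE:
  assumes "v \<in> pverts (legged_clique k)"
  obtains (foot) i where "i < k" "v = foot i" | (knee) i where "i < k" "v = knee i"
    | (hip) i where "i < k" "v = hip i"
  using assms by (auto simp: legged_clique_def leg_def)

lemma legged_clique_arcs [simp]:
  "(foot i, v) \<in> parcs (legged_clique k) \<longleftrightarrow> i < k \<and> v = knee i"
  "(knee i, v) \<in> parcs (legged_clique k) \<longleftrightarrow> i < k \<and> (v = foot i \<or> v = hip i)"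
  "(hip i, v) \<in> parcs (legged_clique k) \<longleftrightarrow>
     i < k \<and> (v = knee i \<or> (\<exists>j<k. j \<noteq> i \<and> v = hip j))"
  by (auto simp: legged_clique_def)

lemma pair_graph_legged_clique: "pair_graph (legged_clique k)"
proof
  fix e assume e: "e \<in> parcs (legged_clique k)"
  show "fst e \<in> pverts (legged_clique k)" "snd e \<in> pverts (legged_clique k)" "fst e \<noteq> snd e"
    using e by (auto simp: legged_clique_def leg_def)
next
  show fin: "finite (pverts (legged_clique k))"
    by (simp add: legged_clique_def leg_def)
  have "parcs (legged_clique k) \<subseteq> pverts (legged_clique k) \<times> pverts (legged_clique k)"
    by (auto simp: legged_clique_def leg_def)
  then show "finite (parcs (legged_clique k))"
    using fin by (auto intro: finite_subset)
  show "symmetric (legged_clique k)"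
    by (auto simp: symmetric_def legged_clique_def intro!: symI)
qed

lemma connected_legged_clique:
  assumes "k > 0"
  shows "connected (with_proj (legged_clique k))"
proof -
  interpret pair_graph "legged_clique k" by (rule pair_graph_legged_clique)
  have hip: "hip i \<rightarrow>\<^sup>*\<^bsub>with_proj (legged_clique k)\<^esub> hip 0" if "i < k" for i
    using that assms by (cases "i = 0") auto
  have knee: "knee i \<rightarrow>\<^sup>*\<^bsub>with_proj (legged_clique k)\<^esub> hip 0" if "i < k" for i
    using that hip by (auto intro: adj_reachable_trans[of _ "hip i"])
  have foot: "foot i \<rightarrow>\<^sup>*\<^bsub>with_proj (legged_clique k)\<^esub> hip 0" if "i < k" for i
    using that knee by (auto intro: adj_reachable_trans[of _ "knee i"])
  have to_root: "u \<rightarrow>\<^sup>*\<^bsub>with_proj (legged_clique k)\<^esub> hip 0" if "u \<in> pverts (legged_clique k)" for u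
    using that by (cases rule: legged_clique_vertE) (simp_all add: foot knee hip)
  have "u \<rightarrow>\<^sup>*\<^bsub>with_proj (legged_clique k)\<^esub> v"
    if "u \<in> pverts (legged_clique k)" "v \<in> pverts (legged_clique k)" for u v
    using to_root[OF that(1)] symmetric_reachable'[OF to_root[OF that(2)]]
    by (rule reachable_trans)
  moreover have "hip 0 \<in> pverts (legged_clique k)" using assms by simp
  ultimately show ?thesis
    by (intro connectedI reachable_mk_symmetricI) (simp_all only: with_proj_simps, blast)
qed

lemma disjoint_family_leg: "disjoint_family_on leg I"
  by (auto simp: disjoint_family_on_def leg_def)

section \<open>The secure domination number of a legged clique\<close>

lemma legged_clique_dominating_setD:
  assumes "dominating_set (with_proj (legged_clique k)) S" "i < k"
  shows "foot i \<in> S \<or> knee i \<in> S"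
    and "hip i \<in> S \<or> knee i \<in> S \<or> (\<exists>j<k. hip j \<in> S)"
  using dominating_setD[OF assms(1), of "foot i"] dominating_setD[OF assms(1), of "hip i"] assms(2)
  by auto

text \<open>
  A foot is defended by its knee, after which the guard on hip \<open>0\<close> covers the hip above that knee.
  A hip is defended by hip \<open>0\<close>, since the knees alone already dominate.
\<close>

lemma legged_clique_secure_witness:
  assumes "k > 0"
  shows "secure_dominating_set (with_proj (legged_clique k)) (insert (hip 0) (knee ` {..<k}))"
    (is "secure_dominating_set ?G ?S")
  unfolding secure_dominating_set_def
proof (intro conjI ballI)
  show "dominating_set ?G ?S"
    using assms by (intro dominating_setI) (auto elim!: legged_clique_vertE)
  fix u assume u: "u \<in> verts ?G - ?S"
  then have "u \<in> pverts (legged_clique k)" by simp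
  then show "\<exists>v\<in>?S. u \<rightarrow>\<^bsub>?G\<^esub> v \<and> dominating_set ?G (?S - {v} \<union> {u})"
  proof (cases rule: legged_clique_vertE)
    case (foot i)
    have "dominating_set ?G (?S - {knee i} \<union> {u})"
    proof (rule dominating_setI)
      show "?S - {knee i} \<union> {u} \<subseteq> verts ?G" using assms foot by auto
      fix x assume "x \<in> verts ?G"
      then have "x \<in> pverts (legged_clique k)" by simp
      then show "x \<in> ?S - {knee i} \<union> {u} \<or> (\<exists>v\<in>?S - {knee i} \<union> {u}. x \<rightarrow>\<^bsub>?G\<^esub> v)"
      proof (cases rule: legged_clique_vertE)
        case (foot j)
        then show ?thesis using \<open>u = foot i\<close> by (cases "j = i") auto
      next
        case (knee j)
        then show ?thesis using \<open>u = foot i\<close> by (cases "j = i") auto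
      next
        case (hip j)
        moreover have "hip 0 \<in> ?S - {knee i} \<union> {u}" by simp
        ultimately show ?thesis using assms by (cases "j = 0") (auto intro!: bexI[of _ "hip 0"])
      qed
    qed
    then show ?thesis using foot by (intro bexI[of _ "knee i"]) auto
  next
    case (knee i)
    then show ?thesis using u by auto
  next
    case (hip i)
    have "dominating_set ?G (?S - {hip 0} \<union> {u})"
    proof (rule dominating_setI)
      show "?S - {hip 0} \<union> {u} \<subseteq> verts ?G" using hip by auto
      fix x assume "x \<in> verts ?G"
      then have "x \<in> pverts (legged_clique k)" by simp
      then show "x \<in> ?S - {hip 0} \<union> {u} \<or> (\<exists>v\<in>?S - {hip 0} \<union> {u}. x \<rightarrow>\<^bsub>?G\<^esub> v)"
        by (cases rule: legged_clique_vertE) auto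
    qed
    moreover have "i \<noteq> 0" using u hip by auto
    ultimately show ?thesis using hip assms by (intro bexI[of _ "hip 0"]) auto
  qed
qed

text \<open>
  With only \<open>k\<close> guards there is exactly one in each leg, and it cannot be on the hip because the
  foot would be undominated. So hip \<open>0\<close> relies on knee \<open>0\<close> alone, and an attack on
  foot \<open>0\<close> pulls that guard away.
\<close>

lemma legged_clique_secure_card_ge:
  assumes "k > 0" and S: "secure_dominating_set (with_proj (legged_clique k)) S"
  shows "k + 1 \<le> card S"
proof (rule ccontr)
  assume few: "\<not> k + 1 \<le> card S"
  interpret pair_graph "legged_clique k" by (rule pair_graph_legged_clique)
  have fin: "finite S" using finite_secure_dominating_set[OF S] pair_finite_verts by simp
  have dom: "dominating_set (with_proj (legged_clique k)) S"
    using S by (simp add: secure_dominating_set_def)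
  have ge: "1 \<le> card (S \<inter> leg i)" if "i < k" for i
  proof -
    have "S \<inter> leg i \<noteq> {}"
      using legged_clique_dominating_setD(1)[OF dom that] by (auto simp: leg_def)
    then show ?thesis using fin by (simp add: Suc_le_eq card_gt_0_iff)
  qed
  have one: "card (S \<inter> leg i) = 1" if "i < k" for i
    using card_gt_disjoint_blocks[OF fin disjoint_family_leg ge that] few by fastforce
  have same: "p = q" if "i < k" "p \<in> S" "q \<in> S" "p \<in> leg i" "q \<in> leg i" for i p q
  proof -
    have "card (S \<inter> leg i) = 1" using one that by simp
    then obtain x where "S \<inter> leg i = {x}" by (rule card_1_singletonE)
    moreover have "p \<in> S \<inter> leg i" "q \<in> S \<inter> leg i" using that by auto
    ultimately show ?thesis by simp
  qed
  have no_hip: "hip i \<notin> S" if "i < k" for i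
  proof
    assume "hip i \<in> S"
    then show False
      using legged_clique_dominating_setD(1)[OF dom that] same[OF that, of "hip i" "foot i"]
        same[OF that, of "hip i" "knee i"]
      by (auto simp: leg_def)
  qed
  have knee: "knee 0 \<in> S"
    using legged_clique_dominating_setD(2)[OF dom assms(1)] no_hip assms(1) by auto
  then have foot: "foot 0 \<notin> S"
    using same[OF assms(1), of "knee 0" "foot 0"] by (auto simp: leg_def)
  obtain v where v: "v \<in> S" "(foot 0, v) \<in> parcs (legged_clique k)"
      and dom': "dominating_set (with_proj (legged_clique k)) (insert (foot 0) (S - {v}))"
    using secure_dominating_setE[OF S, of "foot 0"] foot assms(1) by auto
  then show False
    using legged_clique_dominating_setD(2)[OF dom' assms(1)] no_hip assms(1) by auto
qed

lemma secure_domination_number_legged_clique: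
  assumes "k > 0"
  shows "secure_domination_number (with_proj (legged_clique k)) = k + 1"
proof (rule secure_domination_number_eqI)
  interpret pair_graph "legged_clique k" by (rule pair_graph_legged_clique)
  show "finite (verts (with_proj (legged_clique k)))" using pair_finite_verts by simp
  have "hip 0 \<notin> knee ` {..<k}" by auto
  then show "card (insert (hip 0) (knee ` {..<k})) = k + 1"
    by (simp add: card_image inj_on_def)
qed (use assms legged_clique_secure_witness legged_clique_secure_card_ge in auto)

section \<open>The Mycielskian of a legged clique\<close>

lemma mycielskian_verts [simp]:
  "Orig x \<in> pverts (mycielskian G) \<longleftrightarrow> x \<in> pverts G"
  "Copy x \<in> pverts (mycielskian G) \<longleftrightarrow> x \<in> pverts G"
  "Apex \<in> pverts (mycielskian G)"
  by (auto simp: mycielskian_def)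

lemma mycielskian_arcs [simp]:
  "(Orig x, v) \<in> parcs (mycielskian G) \<longleftrightarrow> (\<exists>y. (x, y) \<in> parcs G \<and> (v = Orig y \<or> v = Copy y))"
  "(Copy x, v) \<in> parcs (mycielskian G) \<longleftrightarrow>
     x \<in> pverts G \<and> v = Apex \<or> (\<exists>y. (x, y) \<in> parcs G \<and> v = Orig y)"
  "(Apex, v) \<in> parcs (mycielskian G) \<longleftrightarrow> (\<exists>x\<in>pverts G. v = Copy x)"
  by (auto simp: mycielskian_def)

definition double_leg :: "nat \<Rightarrow> nat mycielskian_vertex set" where
  "double_leg i = Orig ` leg i \<union> Copy ` leg i"

lemma in_double_leg:
  "Orig (foot i) \<in> double_leg i" "Orig (knee i) \<in> double_leg i" "Orig (hip i) \<in> double_leg i"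
  "Copy (foot i) \<in> double_leg i" "Copy (knee i) \<in> double_leg i" "Copy (hip i) \<in> double_leg i"
  "Apex \<notin> double_leg i"
  by (auto simp: double_leg_def leg_def)

lemma disjoint_family_double_leg: "disjoint_family_on double_leg I"
  by (auto simp: disjoint_family_on_def double_leg_def leg_def)

lemma mycielskian_legged_clique_dominating_setD:
  assumes "dominating_set (with_proj (mycielskian (legged_clique k))) S" "i < k"
  shows "Orig (foot i) \<in> S \<or> Orig (knee i) \<in> S \<or> Copy (knee i) \<in> S"
    and "Orig (knee i) \<in> S \<or> Orig (foot i) \<in> S \<or> Copy (foot i) \<in> S
           \<or> Orig (hip i) \<in> S \<or> Copy (hip i) \<in> S"
    and "Copy (foot i) \<in> S \<or> Orig (knee i) \<in> S \<or> Apex \<in> S"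
    and "Copy (knee i) \<in> S \<or> Orig (foot i) \<in> S \<or> Orig (hip i) \<in> S \<or> Apex \<in> S"
  using dominating_setD[OF assms(1), of "Orig (foot i)"]
    dominating_setD[OF assms(1), of "Orig (knee i)"]
    dominating_setD[OF assms(1), of "Copy (foot i)"]
    dominating_setD[OF assms(1), of "Copy (knee i)"] assms(2)
  by auto

text \<open>
  A single guard must see the foot, which leaves three positions for it. On the foot it loses to an
  attack on the copy of the knee, and on the knee it loses to an attack on the copy of the foot:
  moving that guard uncovers a vertex of the leg, and moving the apex instead
  uncovers the copy that only the apex was covering. On the copy of the knee it leaves the knee
  itself undominated.
\<close>

lemma double_leg_card_ge:
  assumes S: "secure_dominating_set (with_proj (mycielskian (legged_clique k))) S"
    and "finite S" and i: "i < k"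
  shows "2 \<le> card (S \<inter> double_leg i)"
proof (rule ccontr)
  let ?M = "mycielskian (legged_clique k)"
  assume "\<not> 2 \<le> card (S \<inter> double_leg i)"
  then have "card (S \<inter> double_leg i) \<le> Suc 0" by simp
  then have same: "p = q" if "p \<in> S" "q \<in> S" "p \<in> double_leg i" "q \<in> double_leg i" for p q
    using that \<open>finite S\<close> by (auto simp: card_le_Suc0_iff_eq)
  have dom: "dominating_set (with_proj ?M) S"
    using S by (simp add: secure_dominating_set_def)
  note D = mycielskian_legged_clique_dominating_setD[OF _ i]
  consider (foot) "Orig (foot i) \<in> S" | (knee) "Orig (knee i) \<in> S" | (copy) "Copy (knee i) \<in> S"
    using D(1)[OF dom] by blast
  then show False
  proof cases
    case foot
    have out: "q \<notin> S" if "q \<in> double_leg i" "q \<noteq> Orig (foot i)" for q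
      using same[OF _ foot _ in_double_leg(1)] that by blast
    obtain v where v: "v \<in> S" "(Copy (knee i), v) \<in> parcs ?M"
      and dom': "dominating_set (with_proj ?M) (insert (Copy (knee i)) (S - {v}))"
      using secure_dominating_setE[OF S, of "Copy (knee i)"] i by (auto simp: out in_double_leg)
    have "v = Orig (foot i) \<or> v = Apex"
      using v i by (auto simp: out in_double_leg)
    then show False
      using D(2)[OF dom'] D(3)[OF dom'] by (auto simp: out in_double_leg)
  next
    case knee
    have out: "q \<notin> S" if "q \<in> double_leg i" "q \<noteq> Orig (knee i)" for q
      using same[OF _ knee _ in_double_leg(2)] that by blast
    obtain v where v: "v \<in> S" "(Copy (foot i), v) \<in> parcs ?M"
      and dom': "dominating_set (with_proj ?M) (insert (Copy (foot i)) (S - {v}))"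
      using secure_dominating_setE[OF S, of "Copy (foot i)"] i by (auto simp: out in_double_leg)
    have "v = Orig (knee i) \<or> v = Apex" using v by auto
    then show False
      using D(1)[OF dom'] D(4)[OF dom'] by (auto simp: out in_double_leg)
  next
    case copy
    have out: "q \<notin> S" if "q \<in> double_leg i" "q \<noteq> Copy (knee i)" for q
      using same[OF _ copy _ in_double_leg(5)] that by blast
    show False using D(2)[OF dom] by (auto simp: out in_double_leg)
  qed
qed

lemma card_2_no_three:
  assumes "card A = 2" "p \<in> A" "q \<in> A" "r \<in> A"
  shows "p = q \<or> p = r \<or> q = r"
  using assms by (auto simp: card_2_iff)

text \<open>
  Besides a guard on the hip or its copy there is room for one more, and without the apex only the
  knee sees both the foot and its copy. Knee and copy of the hip leave the copy of the knee
  undominated; with knee and hip, an attack on the foot pulls the knee away from the copy of the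
  foot.
\<close>

lemma hip_notin_tight_double_leg:
  assumes S: "secure_dominating_set (with_proj (mycielskian (legged_clique k))) S"
    and i: "i < k" and "Apex \<notin> S" and two: "card (S \<inter> double_leg i) = 2"
  shows "Orig (hip i) \<notin> S" and "Copy (hip i) \<notin> S"
proof -
  let ?M = "mycielskian (legged_clique k)"
  have dom: "dominating_set (with_proj ?M) S"
    using S by (simp add: secure_dominating_set_def)
  note D = mycielskian_legged_clique_dominating_setD[OF _ i]
  have three: "p = q \<or> p = r \<or> q = r"
    if "p \<in> S" "q \<in> S" "r \<in> S" "p \<in> double_leg i" "q \<in> double_leg i" "r \<in> double_leg i" for p q r
    using card_2_no_three[OF two] that by blast
  have only: "Orig (knee i) \<in> S \<and> (\<forall>p \<in> S \<inter> double_leg i. p = Orig (knee i) \<or> p = h)"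
    if h: "h \<in> S" "h = Orig (hip i) \<or> h = Copy (hip i)" for h
  proof -
    have hB: "h \<in> double_leg i" using h in_double_leg by auto
    have "Orig (knee i) \<in> S"
    proof (rule ccontr)
      assume "Orig (knee i) \<notin> S"
      then have "Copy (foot i) \<in> S" "Orig (foot i) \<in> S \<or> Copy (knee i) \<in> S"
        using D(1,3)[OF dom] \<open>Apex \<notin> S\<close> by auto
      then show False
        using three[of h "Copy (foot i)" "Orig (foot i)"] three[of h "Copy (foot i)" "Copy (knee i)"]
          h hB in_double_leg by auto
    qed
    moreover have "p = Orig (knee i) \<or> p = h" if "p \<in> S \<inter> double_leg i" for p
      using three[of "Orig (knee i)" h p] calculation h hB that in_double_leg(2) by auto
    ultimately show ?thesis by blast
  qed
  show "Copy (hip i) \<notin> S"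
  proof
    assume "Copy (hip i) \<in> S"
    then have none: "p \<notin> S" if "p \<in> double_leg i" "p \<noteq> Orig (knee i)" "p \<noteq> Copy (hip i)" for p
      using only[of "Copy (hip i)"] that by blast
    show False
      using D(4)[OF dom] \<open>Apex \<notin> S\<close> by (auto simp: none in_double_leg)
  qed
  show "Orig (hip i) \<notin> S"
  proof
    assume "Orig (hip i) \<in> S"
    then have none: "p \<notin> S" if "p \<in> double_leg i" "p \<noteq> Orig (knee i)" "p \<noteq> Orig (hip i)" for p
      using only[of "Orig (hip i)"] that by blast
    have "Orig (foot i) \<notin> S" by (rule none) (simp_all add: in_double_leg)
    then obtain v where v: "v \<in> S" "(Orig (foot i), v) \<in> parcs ?M"
      and dom': "dominating_set (with_proj ?M) (insert (Orig (foot i)) (S - {v}))"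
      using secure_dominating_setE[OF S, of "Orig (foot i)"] i by auto
    have "v = Orig (knee i)" using v by (auto simp: none in_double_leg)
    then show False
      using D(3)[OF dom'] \<open>Apex \<notin> S\<close> by (auto simp: none in_double_leg)
  qed
qed

lemma mycielskian_legged_clique_secure_card_ge:
  assumes "k > 0" and S: "secure_dominating_set (with_proj (mycielskian (legged_clique k))) S"
  shows "2 * k + 1 \<le> card S"
proof -
  let ?M = "mycielskian (legged_clique k)"
  interpret M: pair_graph ?M
    by (intro pair_graph_mycielskian pair_graph_legged_clique)
  have fin: "finite S" using finite_secure_dominating_set[OF S] M.pair_finite_verts by simp
  note ge = double_leg_card_ge[OF S fin]
  show ?thesis
  proof (cases "Apex \<in> S")
    case True
    have "(S - {Apex}) \<inter> double_leg i = S \<inter> double_leg i" for i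
      using in_double_leg by auto
    then have "2 * k \<le> card (S - {Apex})"
      using card_ge_disjoint_blocks[OF _ disjoint_family_double_leg, of "S - {Apex}"] fin ge by simp
    also have "\<dots> < card S" using fin True by (rule card_Diff1_less)
    finally show ?thesis by simp
  next
    case False
    show ?thesis
    proof (rule ccontr)
      assume few: "\<not> 2 * k + 1 \<le> card S"
      \<comment> \<open>No guard is on a hip, on a copy of a hip or on the apex, so only knee \<open>0\<close> can defend
        the copy of hip \<open>0\<close>. The copy of foot \<open>0\<close> has to be guarded to survive this move, but
        then no third guard remains for the copy of knee \<open>0\<close>.\<close>
      have two: "card (S \<inter> double_leg i) = 2" if "i < k" for i
        using card_gt_disjoint_blocks[OF fin disjoint_family_double_leg ge that] few by fastforce
      note no_hip = hip_notin_tight_double_leg[OF S _ False two]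
      obtain v where v: "v \<in> S" "(Copy (hip 0), v) \<in> parcs ?M"
        and dom': "dominating_set (with_proj ?M) (insert (Copy (hip 0)) (S - {v}))"
        using secure_dominating_setE[OF S, of "Copy (hip 0)"] no_hip assms(1) by auto
      have vk: "v = Orig (knee 0)" using v no_hip False by auto
      have dom: "dominating_set (with_proj ?M) S"
        using S by (simp add: secure_dominating_set_def)
      note D = mycielskian_legged_clique_dominating_setD[OF _ assms(1)]
      have "Copy (foot 0) \<in> S" using D(3)[OF dom'] vk False by auto
      moreover have "Copy (knee 0) \<in> S \<or> Orig (foot 0) \<in> S"
        using D(4)[OF dom] False no_hip[OF assms(1) assms(1)] by auto
      ultimately show False
        using card_2_no_three[OF two[OF assms(1)], of v "Copy (foot 0)" "Copy (knee 0)"]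
          card_2_no_three[OF two[OF assms(1)], of v "Copy (foot 0)" "Orig (foot 0)"]
          v(1) vk in_double_leg by auto
    qed
  qed
qed

text \<open>
  An attacked copy is defended by the apex, which the total dominating set of knees and hips can
  spare; the guard on the copy then dominates the apex. An attacked foot is defended by its knee,
  which is still covered by its hip, while the apex covers all copies.
\<close>

lemma mycielskian_legged_clique_secure_witness:
  "secure_dominating_set (with_proj (mycielskian (legged_clique k)))
    (insert Apex (Orig ` (knee ` {..<k} \<union> hip ` {..<k})))"
    (is "secure_dominating_set ?M ?S")
proof -
  let ?T = "Orig ` (knee ` {..<k} \<union> hip ` {..<k})"
  have total: "\<exists>y. (x, y) \<in> parcs (legged_clique k) \<and> Orig y \<in> ?T"
    if "x \<in> pverts (legged_clique k)" for x
    using that by (cases rule: legged_clique_vertE) auto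
  have dom: "dominating_set ?M (insert u ?T)"
    if "u = Apex \<or> (\<exists>x \<in> pverts (legged_clique k). u = Copy x)" for u
  proof (rule dominating_setI)
    show "insert u ?T \<subseteq> verts ?M" using that by auto
    fix z assume z: "z \<in> verts ?M"
    show "z \<in> insert u ?T \<or> (\<exists>v\<in>insert u ?T. z \<rightarrow>\<^bsub>?M\<^esub> v)"
    proof (cases z)
      case (Orig x)
      then obtain y where "(x, y) \<in> parcs (legged_clique k)" "Orig y \<in> ?T"
        using total[of x] z by auto
      then show ?thesis using Orig by (intro disjI2 bexI[of _ "Orig y"]) auto
    next
      case (Copy x)
      then obtain y where "(x, y) \<in> parcs (legged_clique k)" "Orig y \<in> ?T"
        using total[of x] z by auto
      then show ?thesis using Copy by (intro disjI2 bexI[of _ "Orig y"]) auto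
    next
      case Apex
      then show ?thesis using that by auto
    qed
  qed
  show ?thesis
    unfolding secure_dominating_set_def
  proof (intro conjI ballI)
    show "dominating_set ?M ?S" using dom by simp
    fix u assume u: "u \<in> verts ?M - ?S"
    show "\<exists>v\<in>?S. u \<rightarrow>\<^bsub>?M\<^esub> v \<and> dominating_set ?M (?S - {v} \<union> {u})"
    proof (cases u)
      case (Orig x)
      then have "x \<in> pverts (legged_clique k)" "Orig x \<notin> ?T" using u by auto
      then obtain i where i: "i < k" "x = foot i"
        by (auto elim!: legged_clique_vertE)
      have "dominating_set ?M (?S - {Orig (knee i)} \<union> {u})"
      proof (rule dominating_setI)
        show "?S - {Orig (knee i)} \<union> {u} \<subseteq> verts ?M" using i Orig by auto
        fix z assume z: "z \<in> verts ?M"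
        show "z \<in> ?S - {Orig (knee i)} \<union> {u} \<or> (\<exists>v\<in>?S - {Orig (knee i)} \<union> {u}. z \<rightarrow>\<^bsub>?M\<^esub> v)"
        proof (cases z)
          case z_orig: (Orig y)
          then have "y \<in> pverts (legged_clique k)" using z by simp
          then show ?thesis
          proof (cases rule: legged_clique_vertE)
            case (foot j)
            then show ?thesis using z_orig Orig i by (cases "j = i") auto
          next
            case (knee j)
            then show ?thesis
              using z_orig by (intro disjI2 bexI[of _ "Orig (hip j)"]) auto
          next
            case (hip j)
            then show ?thesis using z_orig by auto
          qed
        next
          case (Copy y)
          then show ?thesis using z by (intro disjI2 bexI[of _ Apex]) auto
        qed auto
      qed
      moreover have "u \<rightarrow>\<^bsub>?M\<^esub> Orig (knee i)" using i Orig by auto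
      ultimately show ?thesis using i(1) by (intro bexI[of _ "Orig (knee i)"]) auto
    next
      case (Copy x)
      then have x: "x \<in> pverts (legged_clique k)" using u by auto
      have eq: "?S - {Apex} \<union> {u} = insert u ?T" by auto
      have "dominating_set ?M (?S - {Apex} \<union> {u})"
        unfolding eq using Copy x by (intro dom) auto
      then show ?thesis using Copy x by (intro bexI[of _ Apex]) auto
    next
      case Apex
      then show ?thesis using u by auto
    qed
  qed
qed

lemma secure_domination_number_mycielskian_legged_clique:
  assumes "k > 0"
  shows "secure_domination_number (with_proj (mycielskian (legged_clique k))) = 2 * k + 1"
proof (rule secure_domination_number_eqI)
  interpret M: pair_graph "mycielskian (legged_clique k)"
    by (intro pair_graph_mycielskian pair_graph_legged_clique)
  show "finite (verts (with_proj (mycielskian (legged_clique k))))"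
    using M.pair_finite_verts by simp
  have "card (knee ` {..<k} \<union> hip ` {..<k}) = card (knee ` {..<k}) + card (hip ` {..<k})"
    by (rule card_Un_disjoint) auto
  also have "\<dots> = 2 * k" by (simp add: card_image inj_on_def)
  finally have "card (Orig ` (knee ` {..<k} \<union> hip ` {..<k})) = 2 * k"
    by (subst card_image) (simp_all add: inj_on_def)
  moreover have "Apex \<notin> Orig ` (knee ` {..<k} \<union> hip ` {..<k})" by auto
  ultimately show "card (insert Apex (Orig ` (knee ` {..<k} \<union> hip ` {..<k}))) = 2 * k + 1"
    by simp
qed (use mycielskian_legged_clique_secure_witness
      mycielskian_legged_clique_secure_card_ge[OF assms] in auto)

theorem proposition4p1:
  fixes k :: nat
  assumes "k > 0"
  shows "\<exists>G :: nat pair_pre_digraph. pair_graph G \<and> connected (with_proj G) \<and>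
    int (secure_domination_number (with_proj (mycielskian G)))
      - int (secure_domination_number (with_proj G)) = int k"
  using assms
  by (intro exI[of _ "legged_clique k"])
    (simp add: pair_graph_legged_clique connected_legged_clique
      secure_domination_number_legged_clique secure_domination_number_mycielskian_legged_clique)

end
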